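(* Let $G$ be a digraph with vertex set $\{1,2,\dots,n\}$, and let $\overrightarrow{G}=G[H_1,H_2,\dots,H_n]$ be a generalized join digraph with respect to $G$, where each $H_i$ is an independent set of order $m_i$ (a digraph with $m_i$ vertices and no edges). For $i^*\in V(G)$ and $u^*\in V(H_{i^*})$, we have $$t_{u^*}(\overrightarrow{G})=\frac{1}{m_{i^*}}\prod_{i\in V(G)}\ \prod_{k=1}^{m_i-1}\left(\sum_{j:\,(i,j)\in E(G)}m_j\right)\cdot\sum_{T\in\mathcal{T}_{i^*}(G)}\ \prod_{(i,j)\in E(T)}m_j .$$
   Context: Digraphs are finite, with nonempty vertex set, without loops or multiple edges (both $(u,v)$ and $(v,u)$ may be edges); $(u,v)$ is directed from $u$ to $v$. Generalized join digraph: $G[H_1,\dots,H_n]$ is obtained from $G$ by replacing each vertex $i$ with $H_i$: its vertex set is the disjoint union $V(H_1)\cup\dots\cup V(H_n)$, the edges inside each $H_i$ are kept, and for $i\ne j$, $u\in V(H_i)$, $v\in V(H_j)$, $(u,v)$ is an edge if and only if $(i,j)\in E(G)$. An oriented spanning tree of a digraph is a subtree containing all its vertices, in which one vertex, the root, has outdegree $0$ and every other vertex has outdegree $1$. $\mathcal{T}_v(G)$ is the set of oriented spanning trees of $G$ with root $v$, and $t_v(G)=|\mathcal{T}_v(G)|$. Empty products equal $1$. *)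

theory Defs
  imports Complex_Main "Graph_Theory.Graph_Theory"
begin

(* Vertices of the disjoint union are tagged with the index of the part they belong to. *)
definition generalized_join ::
  "'a pair_pre_digraph \<Rightarrow> ('a \<Rightarrow> 'b pair_pre_digraph) \<Rightarrow> ('a \<times> 'b) pair_pre_digraph" where
  "generalized_join G H =
    \<lparr> pverts = (SIGMA i:pverts G. pverts (H i)),
      parcs = {((i, u), (j, v)) | i u j v.
        i \<in> pverts G \<and> j \<in> pverts G \<and> u \<in> pverts (H i) \<and> v \<in> pverts (H j) \<and>
        (if i = j then (u, v) \<in> parcs (H i) else (i, j) \<in> parcs G)} \<rparr>"

(* The library's spanning_tree demands that the underlying undirected graph be connected and
   that there be no directed cycle.  For general digraphs this is weaker than the underlying
   graph being a tree, but together with the outdegree conditions it is the same: the number of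
   arcs is then one less than the number of vertices (oriented_spanning_tree_card_arcs below),
   so the connected underlying graph has no undirected cycle and no doubled edge either. *)
definition oriented_spanning_trees :: "'a pair_pre_digraph \<Rightarrow> 'a \<Rightarrow> 'a pair_pre_digraph set" where
  "oriented_spanning_trees G v =
    {T. spanning_tree (with_proj T) (with_proj G) \<and>
        v \<in> pverts T \<and> out_degree (with_proj T) v = 0 \<and>
        (\<forall>u \<in> pverts T - {v}. out_degree (with_proj T) u = 1)}"

definition num_oriented_spanning_trees :: "'a pair_pre_digraph \<Rightarrow> 'a \<Rightarrow> nat" where
  "num_oriented_spanning_trees G v = card (oriented_spanning_trees G v)"

lemma finite_oriented_spanning_trees:
  assumes "pair_fin_digraph G"
  shows "finite (oriented_spanning_trees G v)"
proof (rule finite_subset)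
  show "oriented_spanning_trees G v \<subseteq>
      (\<lambda>A. \<lparr> pverts = pverts G, parcs = A \<rparr>) ` Pow (parcs G)"
    by (auto simp: oriented_spanning_trees_def spanning_tree_def spanning_def subgraph_def
        intro!: image_eqI pair_pre_digraph.equality)
  show "finite ((\<lambda>A. \<lparr> pverts = pverts G, parcs = A \<rparr>) ` Pow (parcs G))"
    using assms by (simp add: pair_fin_digraph.pair_finite_arcs)
qed

lemma oriented_spanning_tree_card_arcs:
  assumes G: "pair_fin_digraph G" and T: "T \<in> oriented_spanning_trees G v"
  shows "card (parcs T) + 1 = card (pverts T)"
proof -
  have sub: "pverts T = pverts G" "parcs T \<subseteq> parcs G" "wf_digraph (with_proj T)"
    using T by (auto simp: oriented_spanning_trees_def spanning_tree_def spanning_def subgraph_def)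
  have fin: "finite (pverts T)" "finite (parcs T)"
    using G sub by (auto simp: pair_fin_digraph.pair_finite_verts
        intro: finite_subset pair_fin_digraph.pair_finite_arcs)
  have tl: "fst e \<in> pverts T" if "e \<in> parcs T" for e
    using wf_digraph.tail_in_verts[OF sub(3), of e] that by simp
  have "card (parcs T) = card (\<Union>u \<in> pverts T. out_arcs (with_proj T) u)"
    by (rule arg_cong[where f = card]) (auto simp: out_arcs_def dest: tl)
  also have "\<dots> = (\<Sum>u \<in> pverts T. out_degree (with_proj T) u)"
    unfolding out_degree_def by (rule card_UN_disjoint) (use fin in \<open>auto simp: out_arcs_def\<close>)
  also have "\<dots> = (\<Sum>u \<in> pverts T - {v}. 1)"
    using T fin by (subst sum.remove[of _ v]) (auto simp: oriented_spanning_trees_def)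
  finally have "card (parcs T) = card (pverts T - {v})" by simp
  moreover have "v \<in> pverts T" using T by (simp add: oriented_spanning_trees_def)
  ultimately show ?thesis using card_Suc_Diff1[OF fin(1)] by simp
qed

end

theory Submission
  imports Defs "HOL-Library.FuncSet" "HOL-Combinatorics.Transposition"
begin

text \<open>
  Two vertices of the join lying in the same independent set are twins: they have the same
  out-neighbours.  Weight the arcs into each vertex \<open>v\<close> by a number \<open>c v\<close>.  Merging a twin \<open>x'\<close>
  into \<open>x\<close>, with \<open>c x\<close> replaced by \<open>c x + c x'\<close>, splits off the common out-weight of the twins as a
  factor from the weighted count of spanning trees, summed over all roots in a fixed class: cut
  the arcs leaving \<open>x\<close> and \<open>x'\<close> and sort the ways to restore them by the components they lead to.
  Starting from \<open>c = 1\<close> and merging until every class is a single vertex, one arrives at \<open>G\<close> with the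
  arcs into \<open>j\<close> weighted by \<open>m j\<close>, having collected the out-weight of class \<open>i\<close> exactly \<open>m i - 1\<close>
  times.  By symmetry all \<open>m istar\<close> roots in the class of \<open>istar\<close> contribute equally.
\<close>

section \<open>Weighted spanning forests\<close>

text \<open>
  Iterating \<^term>\<open>f\<close> from a point until it first meets \<^term>\<open>S\<close>, one ends up in \<^term>\<open>A\<close>;
  so \<open>lands f S UNIV a\<close> only says that \<^term>\<open>S\<close> is reached.
\<close>

inductive lands :: "('a \<Rightarrow> 'a) \<Rightarrow> 'a set \<Rightarrow> 'a set \<Rightarrow> 'a \<Rightarrow> bool"
  for f :: "'a \<Rightarrow> 'a" and S A :: "'a set" where
  stop: "a \<in> S \<Longrightarrow> a \<in> A \<Longrightarrow> lands f S A a"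
| step: "a \<notin> S \<Longrightarrow> lands f S A (f a) \<Longrightarrow> lands f S A a"

lemma lands_stop_iff: "a \<in> S \<Longrightarrow> lands f S A a \<longleftrightarrow> a \<in> A"
  by (auto elim: lands.cases intro: lands.stop)

lemma lands_step_iff: "a \<notin> S \<Longrightarrow> lands f S A a \<longleftrightarrow> lands f S A (f a)"
  by (auto elim: lands.cases intro: lands.step)

lemma lands_mono: "lands f S A a \<Longrightarrow> A \<inter> S \<subseteq> B \<Longrightarrow> lands f S B a"
  by (induction rule: lands.induct) (auto intro: lands.intros)

lemma lands_Un: "lands f S (A \<union> B) a \<longleftrightarrow> lands f S A a \<or> lands f S B a"
proof
  show "lands f S A a \<or> lands f S B a" if "lands f S (A \<union> B) a"
    using that by (induction rule: lands.induct) (auto intro: lands.intros)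
  show "lands f S (A \<union> B) a" if "lands f S A a \<or> lands f S B a"
    using that lands_mono[of f S A a "A \<union> B"] lands_mono[of f S B a "A \<union> B"] by blast
qed

text \<open>The orbit is deterministic, so its first point in \<open>S\<close> is unique; two
  landing facts about \<open>a\<close> therefore speak of the same point.\<close>

lemma lands_Int: "lands f S (A \<inter> B) a \<longleftrightarrow> lands f S A a \<and> lands f S B a"
proof
  have "lands f S A a \<Longrightarrow> lands f S B a \<longrightarrow> lands f S (A \<inter> B) a"
    by (induction rule: lands.induct) (auto simp: lands_stop_iff lands_step_iff)
  then show "lands f S A a \<and> lands f S B a \<Longrightarrow> lands f S (A \<inter> B) a" by blast
  show "lands f S A a \<and> lands f S B a" if "lands f S (A \<inter> B) a"
    using lands_mono[OF that, of A] lands_mono[OF that, of B] by blast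
qed

lemma not_lands_empty: "\<not> lands f S {} a"
proof
  show "lands f S {} a \<Longrightarrow> False"
    by (induction rule: lands.induct) auto
qed

text \<open>The orbit never leaves \<open>V\<close> before it stops, so only the values on
  \<open>V - S\<close> matter. This permits passing to restricted parent functions.\<close>

lemma lands_cong_on:
  assumes "\<And>u. u \<in> V - S \<Longrightarrow> f u = g u \<and> f u \<in> V" and "a \<in> V"
  shows "lands f S A a \<longleftrightarrow> lands g S A a"
proof -
  have *: "lands g S A a"
    if "lands f S A a" "a \<in> V" and eq: "\<And>u. u \<in> V - S \<Longrightarrow> f u = g u \<and> f u \<in> V" for f g a
    using that(1,2)
  proof (induction rule: lands.induct)
    case (step a)
    then have "f a = g a" "f a \<in> V" using eq[of a] by auto
    then show ?case using step by (metis lands.step)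
  qed (rule lands.stop)
  show ?thesis using *[of f a g] *[of g a f] assms by metis
qed

text \<open>\<open>p\<close> carries the orbit of \<open>a\<close> under \<open>f\<close> to the
  orbit of \<open>p a\<close> under \<open>g\<close>, and both stop at the same moment because the
  stopping sets correspond. It will be applied to the map that collapses a twin.\<close>

lemma lands_conj:
  assumes "\<And>a. a \<notin> p -` S \<Longrightarrow> g (p a) = p (f a)"
  shows "lands f (p -` S) (p -` A) a \<longleftrightarrow> lands g S A (p a)"
proof
  show "lands g S A (p a)" if "lands f (p -` S) (p -` A) a"
    using that by (induction rule: lands.induct) (auto simp: lands_stop_iff lands_step_iff assms)
  show "lands f (p -` S) (p -` A) a" if "lands g S A (p a)"
    using that
  proof (induction "p a" arbitrary: a rule: lands.induct)
    case step
    then show ?case using assms[of a] by (auto intro: lands.step)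
  qed (auto intro: lands.stop)
qed

text \<open>Split the orbit at its first visit to \<open>x\<close>: either it reaches
  \<open>R\<close> without meeting \<open>x\<close>, or it meets \<open>x\<close> and goes on from
  \<open>b\<close>. From \<open>b\<close> it must not come back to \<open>x\<close>, since it would
  then run in a cycle and never stop.\<close>

lemma lands_update:
  assumes "x \<notin> R"
  shows "lands (f(x := b)) R A a \<longleftrightarrow>
    lands f (insert x R) (A - {x}) a \<or>
    lands f (insert x R) {x} a \<and> lands f (insert x R) (A - {x}) b"
proof
  show "lands f (insert x R) (A - {x}) a \<or>
      lands f (insert x R) {x} a \<and> lands f (insert x R) (A - {x}) b"
    if "lands (f(x := b)) R A a"
    using that
  proof (induction rule: lands.induct)
    case (stop a)
    then show ?case using assms by (auto intro: lands.stop)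
  next
    case (step a)
    then show ?case by (cases "a = x") (auto simp: lands_stop_iff lands_step_iff)
  qed
  have *: "lands (f(x := b)) R A c" if "lands f (insert x R) (A - {x}) c" for c
    using that by (induction rule: lands.induct) (auto intro: lands.intros)
  have "lands (f(x := b)) R A a"
    if "lands f (insert x R) {x} a" "lands f (insert x R) (A - {x}) b"
    using that(1)
  proof (induction rule: lands.induct)
    case (stop a)
    have "lands (f(x := b)) R A x"
      by (rule lands.step) (use *[OF that(2)] assms in simp_all)
    moreover have "a = x" using stop by simp
    ultimately show ?case by (simp only:)
  qed (auto intro: lands.step)
  then show "lands (f(x := b)) R A a"
    if "lands f (insert x R) (A - {x}) a \<or>
      lands f (insert x R) {x} a \<and> lands f (insert x R) (A - {x}) b"
    using that * by blast
qed

text \<open>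
  A spanning forest with root set \<^term>\<open>R\<close> is represented by its parent function on \<^term>\<open>V - R\<close>.
\<close>

definition forests :: "'a set \<Rightarrow> 'a set \<Rightarrow> ('a \<Rightarrow> 'a) set" where
  "forests V R = {f \<in> (V - R) \<rightarrow>\<^sub>E V. \<forall>a\<in>V. lands f R UNIV a}"

text \<open>No arc set enters: missing arcs are given weight 0, so that forests using them
  contribute nothing.\<close>

definition forest_sum :: "'a set \<Rightarrow> 'a set \<Rightarrow> ('a \<Rightarrow> 'a \<Rightarrow> 'c::comm_semiring_1) \<Rightarrow> 'c" where
  "forest_sum V R w = (\<Sum>f\<in>forests V R. \<Prod>u\<in>V - R. w u (f u))"

lemma finite_forests: "finite V \<Longrightarrow> finite (forests V R)"
  unfolding forests_def by (auto intro!: finite_PiE intro: finite_subset[of _ "(V - R) \<rightarrow>\<^sub>E V"])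

lemma forests_in: "f \<in> forests V R \<Longrightarrow> u \<in> V - R \<Longrightarrow> f u \<in> V"
  by (auto simp: forests_def)

lemma forests_lands: "f \<in> forests V R \<Longrightarrow> a \<in> V \<Longrightarrow> lands f R UNIV a"
  by (auto simp: forests_def)

text \<open>A forest in which \<open>x\<close> is no root arises from one in which \<open>x\<close>
  is a root by choosing a parent \<open>b\<close> of \<open>x\<close>. The choice is legal exactly
  when \<open>b\<close> lies outside the component of \<open>x\<close>, as otherwise a cycle is
  closed.\<close>

lemma sum_forests_release:
  assumes "finite V" "x \<in> V - R"
  shows "(\<Sum>g\<in>forests V R. \<phi> g) =
    (\<Sum>f\<in>forests V (insert x R).
      \<Sum>b | b \<in> V \<and> lands f (insert x R) (- {x}) b. \<phi> (f(x := b)))"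
proof -
  let ?B = "\<lambda>f. {b. b \<in> V \<and> lands f (insert x R) (- {x}) b}"
  have x: "x \<in> V" "x \<notin> R" using assms by auto
  have "(\<Sum>g\<in>forests V R. \<phi> g) = (\<Sum>(f, b)\<in>(SIGMA f:forests V (insert x R). ?B f). \<phi> (f(x := b)))"
  proof (rule sum.reindex_bij_witness[where i = "\<lambda>(f, b). f(x := b)"
        and j = "\<lambda>g. (g(x := undefined), g x)"])
    fix g assume g: "g \<in> forests V R"
    \<comment> \<open>Parent functions are extensional, so making \<open>x\<close> a root must reset
      its value to \<open>undefined\<close>.\<close>
    let ?f = "g(x := undefined)"
    have upd: "lands g R A a \<longleftrightarrow> lands ?f (insert x R) (A - {x}) a \<or>
        lands ?f (insert x R) {x} a \<and> lands ?f (insert x R) (A - {x}) (g x)" for A a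
      using lands_update[OF x(2), of ?f "g x" A a] by simp
    have "g x \<in> V" using g x by (auto simp: forests_def)
    moreover have "lands ?f (insert x R) UNIV a" if "a \<in> V" for a
      using forests_lands[OF g that] upd[of UNIV a]
        lands_mono[of ?f "insert x R" "UNIV - {x}" a UNIV] lands_mono[of ?f "insert x R" "{x}" a UNIV]
      by blast
    \<comment> \<open>No cycle was closed: in \<open>upd\<close> at \<open>a = x\<close> the first
      alternative fails because \<open>x\<close> stops at itself, and the second one says that
      \<open>g x\<close> lands away from \<open>x\<close>.\<close>
    moreover have "?f \<in> (V - insert x R) \<rightarrow>\<^sub>E V"
      using g by (auto simp: forests_def PiE_def extensional_def)
    moreover have "lands ?f (insert x R) (- {x}) (g x)"
      using forests_lands[OF g x(1)] upd[of UNIV x] by (auto simp: lands_stop_iff Compl_eq_Diff_UNIV)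
    ultimately show "(\<lambda>g. (?f, g x)) g \<in> (SIGMA f:forests V (insert x R). ?B f)"
      by (auto simp: forests_def)
  next
    fix p assume "p \<in> (SIGMA f:forests V (insert x R). ?B f)"
    then obtain f b where p: "p = (f, b)" and f: "f \<in> forests V (insert x R)" and b: "b \<in> V"
      "lands f (insert x R) (- {x}) b" by auto
    have "lands (f(x := b)) R UNIV a" if "a \<in> V" for a
    proof -
      have "lands f (insert x R) (- {x} \<union> {x}) a"
        using forests_lands[OF f that] by (rule lands_mono) auto
      then show ?thesis
        using b(2) unfolding lands_Un lands_update[OF x(2)] Compl_eq_Diff_UNIV by blast
    qed
    moreover have "f(x := b) \<in> (V - R) \<rightarrow>\<^sub>E V"
      using f b x by (auto simp: forests_def PiE_def extensional_def)
    ultimately show "(\<lambda>(f, b). f(x := b)) p \<in> forests V R" by (auto simp: p forests_def)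
    have "f x = undefined" using f by (auto simp: forests_def PiE_def extensional_def)
    then show "(\<lambda>g. (g(x := undefined), g x)) ((\<lambda>(f, b). f(x := b)) p) = p"
      by (auto simp: p)
  qed auto
  also have "\<dots> = (\<Sum>f\<in>forests V (insert x R). \<Sum>b\<in>?B f. \<phi> (f(x := b)))"
    by (rule sum.Sigma[symmetric]) (use assms finite_forests in auto)
  finally show ?thesis .
qed

lemma prod_release:
  assumes "finite V" "x \<in> V - R"
  shows "(\<Prod>u\<in>V - R. w u ((f(x := b)) u)) = w x b * (\<Prod>u\<in>V - insert x R. w u (f u))"
proof -
  have ins: "V - R = insert x (V - insert x R)" using assms by auto
  have "(\<Prod>u\<in>V - R. w u ((f(x := b)) u)) =
      w x b * (\<Prod>u\<in>V - insert x R. w u ((f(x := b)) u))"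
    by (subst ins) (use assms(1) in simp)
  also have "(\<Prod>u\<in>V - insert x R. w u ((f(x := b)) u)) = (\<Prod>u\<in>V - insert x R. w u (f u))"
    by (rule prod.cong) auto
  finally show ?thesis .
qed

lemma forest_sum_release:
  assumes "finite V" "x \<in> V - R"
  shows "forest_sum V R w = (\<Sum>f\<in>forests V (insert x R). (\<Prod>u\<in>V - insert x R. w u (f u)) *
      (\<Sum>b | b \<in> V \<and> lands f (insert x R) (- {x}) b. w x b))"
  unfolding forest_sum_def sum_forests_release[OF assms] sum_distrib_left
proof (intro sum.cong refl)
  show "(\<Prod>u\<in>V - R. w u ((f(x := b)) u)) = (\<Prod>u\<in>V - insert x R. w u (f u)) * w x b" for f b
    by (rule trans[OF prod_release[OF assms] mult.commute])
qed

section \<open>Merging twin vertices\<close>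

text \<open>Contracting \<open>x'\<close> into \<open>x\<close> fuses the arcs into the two, so
  columns are added. The row of \<open>x\<close> is not added to that of \<open>x'\<close>, since
  twins have equal rows and the merged vertex keeps this common row.\<close>

definition merge_weight :: "'a \<Rightarrow> 'a \<Rightarrow> ('a \<Rightarrow> 'a \<Rightarrow> 'c::comm_semiring_1) \<Rightarrow> 'a \<Rightarrow> 'a \<Rightarrow> 'c" where
  "merge_weight x x' w u v = (if v = x then w u x + w u x' else w u v)"

text \<open>Both twins are stopping points, so contracting them never has to reconcile two outgoing
  arcs, and \<open>id(x' := x)\<close> is a semiconjugacy in the sense of
  \<open>lands_conj\<close>.\<close>

lemma lands_merge:
  assumes h: "h \<in> V - insert x' S \<rightarrow> V" and a: "a \<in> V" and S: "x \<in> S" "x' \<notin> S"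
  shows "lands h (insert x' S) ((id(x' := x)) -` A) a \<longleftrightarrow>
    lands (restrict (id(x' := x) \<circ> h) (V - insert x' S)) S A ((id(x' := x)) a)"
proof -
  define p where "p = id(x' := x)"
  have pS: "p -` S = insert x' S" using S by (auto simp: p_def split: if_splits)
  have pV: "y \<in> V \<Longrightarrow> p y \<in> insert x V - {x'}" for y using S by (auto simp: p_def)
  have "lands h (insert x' S) (p -` A) a \<longleftrightarrow> lands (p \<circ> h) S A (p a)"
    using lands_conj[of p S "p \<circ> h" h A a] unfolding pS by (simp add: p_def)
  also have "\<dots> \<longleftrightarrow> lands (restrict (p \<circ> h) (V - insert x' S)) S A (p a)"
  \<comment> \<open>This set contains the image of \<open>V\<close> under \<open>p\<close>;
    \<open>x\<close> is inserted because the hypotheses do not place it in \<open>V\<close>.\<close>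
  proof (rule lands_cong_on[where V = "insert x V - {x'}"])
    fix u assume "u \<in> insert x V - {x'} - S"
    then have "u \<in> V - insert x' S" using S by auto
    moreover from this have "h u \<in> V" using h by auto
    ultimately show "(p \<circ> h) u = restrict (p \<circ> h) (V - insert x' S) u \<and>
        (p \<circ> h) u \<in> insert x V - {x'}"
      using pV by auto
  qed (use pV[OF a] in simp)
  finally show ?thesis by (simp add: p_def)
qed

text \<open>Group the forests by their contraction \<open>g\<close>. Each vertex whose parent in
  \<open>g\<close> is \<open>x\<close> may independently have had \<open>x\<close> or
  \<open>x'\<close> as parent, so a fibre is a product of sets and its weight factors into merged
  weights. A factor \<open>\<phi>\<close> determined by the contraction passes through as
  \<open>\<psi>\<close>.\<close>

lemma sum_forests_merge:
  fixes w :: "'a \<Rightarrow> 'a \<Rightarrow> 'c::comm_semiring_1"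
  assumes V: "finite V" "x' \<in> V" and S: "x \<in> S" "x' \<notin> S" "S \<subseteq> V"
    and \<phi>: "\<And>h. h \<in> forests V (insert x' S) \<Longrightarrow>
      \<phi> h = \<psi> (restrict (id(x' := x) \<circ> h) (V - insert x' S))"
  shows "(\<Sum>h\<in>forests V (insert x' S). (\<Prod>u\<in>V - insert x' S. w u (h u)) * \<phi> h) =
    (\<Sum>g\<in>forests (V - {x'}) S. (\<Prod>u\<in>V - insert x' S. merge_weight x x' w u (g u)) * \<psi> g)"
proof -
  define p where "p = id(x' := x)"
  let ?D = "V - insert x' S"
  let ?q = "\<lambda>h. restrict (p \<circ> h) ?D"
  have D: "?D = V - {x'} - S" by auto
  have xx: "x \<noteq> x'" using S by auto
  have p[simp]: "p x' = x" "y \<noteq> x' \<Longrightarrow> p y = y" for y by (auto simp: p_def)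
  have pV: "p y \<in> V - {x'}" if "y \<in> V" for y using that S xx by (cases "y = x'") auto
  have lands_q: "lands h (insert x' S) UNIV a \<longleftrightarrow> lands (?q h) S UNIV (p a)"
    if "h \<in> ?D \<rightarrow> V" "a \<in> V" for h a
    using lands_merge[OF that S(1,2), of UNIV] by (simp add: p_def)
  have q_in: "?q h \<in> forests (V - {x'}) S" if "h \<in> forests V (insert x' S)" for h
  proof -
    have h: "h \<in> ?D \<rightarrow> V" using that by (auto simp: forests_def)
    have "lands (?q h) S UNIV a" if "a \<in> V - {x'}" for a
      using lands_q[OF h, of a] forests_lands[OF \<open>h \<in> forests V (insert x' S)\<close>, of a] that by simp
    moreover have "p (h u) \<in> V - {x'}" if "u \<in> ?D" for u
      using pV[of "h u"] h that by blast
    then have "?q h \<in> ?D \<rightarrow>\<^sub>E (V - {x'})" by simp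
    ultimately show ?thesis unfolding forests_def D[symmetric] by simp
  qed
  have fibre: "{h \<in> forests V (insert x' S). ?q h = g} = PiE ?D (\<lambda>u. {y\<in>V. p y = g u})"
    if g: "g \<in> forests (V - {x'}) S" for g
  proof (intro equalityI subsetI)
    fix h assume "h \<in> {h \<in> forests V (insert x' S). ?q h = g}"
    then have h: "h \<in> ?D \<rightarrow>\<^sub>E V" and q: "?q h = g" by (auto simp: forests_def)
    have "p (h u) = g u" if "u \<in> ?D" for u
      using fun_cong[OF q, of u] that by (simp only: restrict_apply' comp_apply)
    then show "h \<in> PiE ?D (\<lambda>u. {y\<in>V. p y = g u})" using h by auto
  next
    fix h assume h: "h \<in> PiE ?D (\<lambda>u. {y\<in>V. p y = g u})"
    have g_ext: "g \<in> extensional ?D" using g unfolding forests_def D by (auto simp: PiE_def)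
    have eq: "p (h u) = g u" if "u \<in> ?D" for u
      using h that by auto
    have q: "?q h = g"
      using g_ext eq by (intro ext) (auto simp: extensional_def)
    have hV: "h \<in> ?D \<rightarrow> V" using h by auto
    have "lands h (insert x' S) UNIV a" if "a \<in> V" for a
      unfolding lands_q[OF hV that] q using g pV[OF that] by (auto simp: forests_def)
    then show "h \<in> {h \<in> forests V (insert x' S). ?q h = g}"
      using h q by (auto simp: forests_def)
  qed
  have mw: "(\<Sum>y | y \<in> V \<and> p y = v. w u y) = merge_weight x x' w u v" if "v \<in> V - {x'}" for u v
  proof (cases "v = x")
    case True
    then have "{y. y \<in> V \<and> p y = v} = {x, x'}" using S V xx by (auto simp: p_def)
    then show ?thesis using xx True by (simp add: merge_weight_def)
  next
    case False
    then have "{y. y \<in> V \<and> p y = v} = {v}" using that by (auto simp: p_def)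
    then show ?thesis using False by (simp add: merge_weight_def)
  qed
  have "(\<Sum>h\<in>forests V (insert x' S). (\<Prod>u\<in>?D. w u (h u)) * \<phi> h) =
      (\<Sum>g\<in>forests (V - {x'}) S. \<Sum>h | h \<in> forests V (insert x' S) \<and> ?q h = g.
        (\<Prod>u\<in>?D. w u (h u)) * \<phi> h)"
    by (rule sum.group[symmetric]) (use V q_in in \<open>auto simp: finite_forests\<close>)
  also have "\<dots> = (\<Sum>g\<in>forests (V - {x'}) S. (\<Prod>u\<in>?D. merge_weight x x' w u (g u)) * \<psi> g)"
  proof (rule sum.cong[OF refl])
    fix g assume g: "g \<in> forests (V - {x'}) S"
    have "(\<Sum>h | h \<in> forests V (insert x' S) \<and> ?q h = g. (\<Prod>u\<in>?D. w u (h u)) * \<phi> h) =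
        (\<Sum>h | h \<in> forests V (insert x' S) \<and> ?q h = g. (\<Prod>u\<in>?D. w u (h u)) * \<psi> g)"
      by (rule sum.cong) (use \<phi> in \<open>auto simp: p_def\<close>)
    also have "\<dots> = (\<Sum>h\<in>PiE ?D (\<lambda>u. {y\<in>V. p y = g u}). \<Prod>u\<in>?D. w u (h u)) * \<psi> g"
      unfolding fibre[OF g] by (simp add: sum_distrib_right)
    also have "\<dots> = (\<Prod>u\<in>?D. \<Sum>y | y \<in> V \<and> p y = g u. w u y) * \<psi> g"
      by (subst prod_sum_PiE) (use V in auto)
    also have "(\<Prod>u\<in>?D. \<Sum>y | y \<in> V \<and> p y = g u. w u y) =
        (\<Prod>u\<in>?D. merge_weight x x' w u (g u))"
      by (rule prod.cong[OF refl], rule mw) (use forests_in[OF g] in auto)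
    finally show "(\<Sum>h | h \<in> forests V (insert x' S) \<and> ?q h = g. (\<Prod>u\<in>?D. w u (h u)) * \<phi> h) =
        (\<Prod>u\<in>?D. merge_weight x x' w u (g u)) * \<psi> g" .
  qed
  finally show ?thesis .
qed

lemma lands_restrict: "lands f S A a \<longleftrightarrow> lands f S (A \<inter> S) a"
  using lands_mono[of f S A a "A \<inter> S"] lands_mono[of f S "A \<inter> S" a A] by blast

lemma sum_lands_Un:
  assumes "finite V" "A \<inter> B = {}"
  shows "(\<Sum>b | b \<in> V \<and> lands f S (A \<union> B) b. \<phi> b) =
    (\<Sum>b | b \<in> V \<and> lands f S A b. \<phi> b) + (\<Sum>b | b \<in> V \<and> lands f S B b. \<phi> b)"
proof -
  have "{b. b \<in> V \<and> lands f S (A \<union> B) b} =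
      {b. b \<in> V \<and> lands f S A b} \<union> {b. b \<in> V \<and> lands f S B b}"
    by (auto simp: lands_Un)
  moreover have "{b. b \<in> V \<and> lands f S A b} \<inter> {b. b \<in> V \<and> lands f S B b} = {}"
    using lands_Int[of f S A B] by (auto simp: assms not_lands_empty)
  ultimately show ?thesis using assms(1) by (simp add: sum.union_disjoint)
qed

text \<open>Both sums range over the same forests with roots \<open>x\<close> and \<open>x'\<close>:
  with root \<open>x\<close>, the vertex \<open>x'\<close> gets an arc into the component of
  \<open>x\<close>, and conversely. As the twins have equal rows, the two out-weights add up to the
  full row sum.\<close>

lemma forest_sum_merge_roots:
  fixes w :: "'a \<Rightarrow> 'a \<Rightarrow> 'c::comm_semiring_1"
  assumes V: "finite V" "x \<in> V" "x' \<in> V" "x \<noteq> x'"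
    and twins: "\<And>v. v \<in> V \<Longrightarrow> w x' v = w x v"
  shows "forest_sum V {x} w + forest_sum V {x'} w =
    (\<Sum>v\<in>V. w x v) * forest_sum (V - {x'}) {x} (merge_weight x x' w)"
proof -
  let ?F = "forests V {x, x'}" and ?P = "\<lambda>f. \<Prod>u\<in>V - {x, x'}. w u (f u)"
  have ins: "insert x' {x} = {x, x'}" by auto
  \<comment> \<open>With only two roots, missing one means landing in the other.\<close>
  have lands_other: "lands h {x, x'} (- {x'}) b \<longleftrightarrow> lands h {x, x'} {x} b"
    "lands h {x, x'} (- {x}) b \<longleftrightarrow> lands h {x, x'} {x'} b" for h b
    using V(4) lands_restrict[of h "{x, x'}" "- {x'}" b] lands_restrict[of h "{x, x'}" "- {x}" b]
    by (simp_all add: Int_insert_right)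
  have x: "forest_sum V {x} w =
      (\<Sum>h\<in>?F. ?P h * (\<Sum>b | b \<in> V \<and> lands h {x, x'} {x} b. w x b))"
    using forest_sum_release[of V x' "{x}" w] V twins by (simp add: ins lands_other)
  have x': "forest_sum V {x'} w =
      (\<Sum>h\<in>?F. ?P h * (\<Sum>b | b \<in> V \<and> lands h {x, x'} {x'} b. w x b))"
    using forest_sum_release[of V x "{x'}" w] V by (simp add: lands_other)
  have total: "(\<Sum>b | b \<in> V \<and> lands h {x, x'} {x} b. w x b) +
      (\<Sum>b | b \<in> V \<and> lands h {x, x'} {x'} b. w x b) = (\<Sum>v\<in>V. w x v)" if "h \<in> ?F" for h
  proof -
    have "lands h {x, x'} {x, x'} b" if "b \<in> V" for b
      using forests_lands[OF \<open>h \<in> ?F\<close> that] lands_restrict[of h "{x, x'}" UNIV b] by simp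
    then have "{b. b \<in> V \<and> lands h {x, x'} ({x} \<union> {x'}) b} = V"
      by (auto simp: insert_commute)
    then show ?thesis using sum_lands_Un[of V "{x}" "{x'}" "w x" h "{x, x'}"] V by simp
  qed
  have "forest_sum V {x} w + forest_sum V {x'} w = (\<Sum>h\<in>?F. ?P h * (\<Sum>v\<in>V. w x v))"
    unfolding x x' sum.distrib[symmetric] distrib_left[symmetric] using total by simp
  also have "\<dots> = (\<Sum>g\<in>forests (V - {x'}) {x}.
      (\<Prod>u\<in>V - {x, x'}. merge_weight x x' w u (g u)) * (\<Sum>v\<in>V. w x v))"
    using sum_forests_merge[of V x' x "{x}" "\<lambda>_. \<Sum>v\<in>V. w x v" "\<lambda>_. \<Sum>v\<in>V. w x v" w] V
    by (simp add: ins)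
  also have "\<dots> = (\<Sum>v\<in>V. w x v) * forest_sum (V - {x'}) {x} (merge_weight x x' w)"
  proof -
    have "V - {x'} - {x} = V - {x, x'}" by auto
    moreover have "(\<Sum>g\<in>A. P g * d) = d * (\<Sum>g\<in>A. P g)" for A and P :: "('a \<Rightarrow> 'a) \<Rightarrow> 'c" and d
      by (simp add: sum_distrib_left mult.commute)
    ultimately show ?thesis unfolding forest_sum_def by (simp only:)
  qed
  finally show ?thesis .
qed

text \<open>
  Deleting the arcs leaving the twins \<^term>\<open>x\<close>, \<^term>\<open>x'\<close> leaves a forest in which the common
  out-weight \<open>d\<close> of the twins splits as \<open>W0 + W + W'\<close>, according to whether an arc leads to the
  component of a root in \<^term>\<open>R\<close>, of \<^term>\<open>x\<close> or of \<^term>\<open>x'\<close>.  The arcs of the twins that restore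
  a forest rooted at \<^term>\<open>R\<close> have total weight \<open>W0 * (W0 + W') + W * W0 = W0 * d\<close>, and \<open>W0\<close> is the
  weight of the arcs that restore such a forest after merging \<^term>\<open>x'\<close> into \<^term>\<open>x\<close>.
\<close>

lemma forest_sum_merge_nonroots:
  fixes w :: "'a \<Rightarrow> 'a \<Rightarrow> 'c::comm_semiring_1"
  assumes V: "finite V" "x \<in> V - R" "x' \<in> V - R" "x \<noteq> x'" "R \<subseteq> V"
    and twins: "\<And>v. v \<in> V \<Longrightarrow> w x' v = w x v"
  shows "forest_sum V R w =
    (\<Sum>v\<in>V. w x v) * forest_sum (V - {x'}) R (merge_weight x x' w)"
proof -
  let ?S = "insert x R"
  let ?S' = "insert x' ?S" and ?d = "\<Sum>v\<in>V. w x v"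
  let ?P = "\<lambda>h. \<Prod>u\<in>V - ?S'. w u (h u)"
  let ?W = "\<lambda>h A. \<Sum>b | b \<in> V \<and> lands h ?S' A b. w x b"
  have x'S: "x' \<in> V - ?S" and xR: "x \<in> V - R" using V by auto
  have split_x: "- {x'} = - {x, x'} \<union> {x}" and split_x': "UNIV = - {x'} \<union> {x'}" using V by auto
  have total: "?W h (- {x, x'}) + ?W h {x} + ?W h {x'} = ?d" if "h \<in> forests V ?S'" for h
  proof -
    have "{b. b \<in> V \<and> lands h ?S' UNIV b} = V" using forests_lands[OF that] by auto
    moreover have "?W h UNIV = ?W h (- {x'}) + ?W h {x'}"
      by (subst split_x', rule sum_lands_Un) (use V in auto)
    moreover have "?W h (- {x'}) = ?W h (- {x, x'}) + ?W h {x}"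
      by (subst split_x, rule sum_lands_Un) (use V in auto)
    ultimately show ?thesis by simp
  qed
  \<comment> \<open>Once \<open>x'\<close> points to \<open>c\<close>, its component joins that of
    \<open>c\<close>. Hence \<open>x\<close> may point into it exactly when \<open>c\<close> leads
    to \<open>R\<close>.\<close>
  have inner: "(\<Sum>b | b \<in> V \<and> lands (h(x' := c)) ?S (- {x}) b. w x b) =
      ?W h (- {x, x'}) + (if lands h ?S' (- {x, x'}) c then ?W h {x'} else 0)" for h c
  proof -
    have eq: "- {x} - {x'} = - {x, x'}" by auto
    have upd: "lands (h(x' := c)) ?S (- {x}) b \<longleftrightarrow> lands h ?S' (- {x, x'}) b \<or>
        lands h ?S' {x'} b \<and> lands h ?S' (- {x, x'}) c" for b
      using lands_update[of x' ?S h c "- {x}" b] x'S unfolding eq by blast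
    show ?thesis
    proof (cases "lands h ?S' (- {x, x'}) c")
      case True
      then have "lands (h(x' := c)) ?S (- {x}) = lands h ?S' (- {x, x'} \<union> {x'})"
        unfolding fun_eq_iff lands_Un upd by blast
      then show ?thesis
        using True sum_lands_Un[of V "- {x, x'}" "{x'}" "w x" h ?S'] V(1) by (simp only:) simp
    next
      case False
      then show ?thesis by (simp add: upd)
    qed
  qed
  have middle: "(\<Sum>c | c \<in> V \<and> lands h ?S' (- {x'}) c. w x c *
      (?W h (- {x, x'}) + (if lands h ?S' (- {x, x'}) c then ?W h {x'} else 0))) =
      ?d * ?W h (- {x, x'})" (is "?L = _") if h: "h \<in> forests V ?S'" for h
  proof -
    let ?\<phi> = "\<lambda>c. w x c * (?W h (- {x, x'}) + (if lands h ?S' (- {x, x'}) c then ?W h {x'} else 0))"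
    have "?L = (\<Sum>c | c \<in> V \<and> lands h ?S' (- {x, x'}) c. ?\<phi> c) +
        (\<Sum>c | c \<in> V \<and> lands h ?S' {x} c. ?\<phi> c)"
      by (subst split_x, rule sum_lands_Un) (use V in auto)
    also have "(\<Sum>c | c \<in> V \<and> lands h ?S' (- {x, x'}) c. ?\<phi> c) =
        ?W h (- {x, x'}) * (?W h (- {x, x'}) + ?W h {x'})"
      unfolding sum_distrib_right[of "w x"] by (rule sum.cong) auto
    also have "(\<Sum>c | c \<in> V \<and> lands h ?S' {x} c. ?\<phi> c) = ?W h {x} * ?W h (- {x, x'})"
      unfolding sum_distrib_right[of "w x"]
    proof (rule sum.cong)
      fix c assume "c \<in> {c. c \<in> V \<and> lands h ?S' {x} c}"
      then have "\<not> lands h ?S' (- {x, x'}) c"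
        using lands_Int[of h ?S' "- {x, x'}" "{x}" c] by (auto simp: not_lands_empty)
      then show "?\<phi> c = w x c * ?W h (- {x, x'})" by simp
    qed simp
    finally show ?thesis unfolding total[OF h, symmetric] by (simp add: algebra_simps)
  qed
  have "forest_sum V R w = (\<Sum>f\<in>forests V ?S. (\<Prod>u\<in>V - ?S. w u (f u)) *
      (\<Sum>b | b \<in> V \<and> lands f ?S (- {x}) b. w x b))"
    by (rule forest_sum_release[OF V(1) xR])
  also have "\<dots> = (\<Sum>h\<in>forests V ?S'. \<Sum>c | c \<in> V \<and> lands h ?S' (- {x'}) c.
      (\<Prod>u\<in>V - ?S. w u ((h(x' := c)) u)) *
      (\<Sum>b | b \<in> V \<and> lands (h(x' := c)) ?S (- {x}) b. w x b))"
    by (rule sum_forests_release[OF V(1) x'S])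
  also have "\<dots> = (\<Sum>h\<in>forests V ?S'. ?P h * (?d * ?W h (- {x, x'})))"
  proof (rule sum.cong[OF refl])
    fix h assume h: "h \<in> forests V ?S'"
    show "(\<Sum>c | c \<in> V \<and> lands h ?S' (- {x'}) c. (\<Prod>u\<in>V - ?S. w u ((h(x' := c)) u)) *
        (\<Sum>b | b \<in> V \<and> lands (h(x' := c)) ?S (- {x}) b. w x b)) = ?P h * (?d * ?W h (- {x, x'}))"
      unfolding middle[OF h, symmetric] sum_distrib_left[of "?P h"]
    proof (rule sum.cong[OF refl])
      fix c assume "c \<in> {c. c \<in> V \<and> lands h ?S' (- {x'}) c}"
      then have "w x' c = w x c" using twins by simp
      then show "(\<Prod>u\<in>V - ?S. w u ((h(x' := c)) u)) *
          (\<Sum>b | b \<in> V \<and> lands (h(x' := c)) ?S (- {x}) b. w x b) =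
          ?P h * (w x c *
            (?W h (- {x, x'}) + (if lands h ?S' (- {x, x'}) c then ?W h {x'} else 0)))"
        unfolding inner prod_release[OF V(1) x'S, of w h c] by (simp only: ac_simps)
    qed
  qed
  also have "\<dots> = (\<Sum>g\<in>forests (V - {x'}) ?S.
      (\<Prod>u\<in>V - ?S'. merge_weight x x' w u (g u)) *
      (?d * (\<Sum>b | b \<in> V - {x'} \<and> lands g ?S (- {x}) b. merge_weight x x' w x b)))"
  proof (rule sum_forests_merge)
    fix h assume h: "h \<in> forests V ?S'"
    let ?g = "restrict (id(x' := x) \<circ> h) (V - ?S')"
    have pre: "(id(x' := x)) -` (- {x}) = - {x, x'}" using V by auto
    have hV: "h \<in> V - ?S' \<rightarrow> V" using h by (auto simp: forests_def)
    have iff: "lands h ?S' (- {x, x'}) b \<longleftrightarrow> lands ?g ?S (- {x}) b" if "b \<in> V - {x'}" for b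
      using lands_merge[OF hV, of b x "- {x}"] x'S that unfolding pre by simp
    have "?W h (- {x, x'}) =
        (\<Sum>b | b \<in> V - {x'} \<and> lands ?g ?S (- {x}) b. merge_weight x x' w x b)"
    proof (rule sum.cong)
      \<comment> \<open>The vertex \<open>x'\<close> lands in itself, so it is missing on the left
        as well.\<close>
      show "{b. b \<in> V \<and> lands h ?S' (- {x, x'}) b} =
          {b. b \<in> V - {x'} \<and> lands ?g ?S (- {x}) b}"
        using iff lands_stop_iff[of x' ?S' h "- {x, x'}"] by auto
      \<comment> \<open>A vertex landing away from \<open>x\<close> is not \<open>x\<close>, and
        only the column of \<open>x\<close> was changed.\<close>
      show "w x b = merge_weight x x' w x b"
        if "b \<in> {b. b \<in> V - {x'} \<and> lands ?g ?S (- {x}) b}" for b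
        using that lands_stop_iff[of x ?S ?g "- {x}"] by (auto simp: merge_weight_def)
    qed
    then show "?d * ?W h (- {x, x'}) =
        ?d * (\<Sum>b | b \<in> V - {x'} \<and> lands ?g ?S (- {x}) b. merge_weight x x' w x b)"
      by simp
  qed (use V in auto)
  also have "\<dots> = ?d * forest_sum (V - {x'}) R (merge_weight x x' w)"
  proof -
    have "V - {x'} - ?S = V - ?S'" by auto
    moreover have "x \<in> V - {x'} - R" using V by auto
    ultimately have "forest_sum (V - {x'}) R (merge_weight x x' w) =
        (\<Sum>g\<in>forests (V - {x'}) ?S. (\<Prod>u\<in>V - ?S'. merge_weight x x' w u (g u)) *
          (\<Sum>b | b \<in> V - {x'} \<and> lands g ?S (- {x}) b. merge_weight x x' w x b))"
      using forest_sum_release[of "V - {x'}" x R "merge_weight x x' w"] V(1) by simp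
    moreover have "(\<Sum>g\<in>A. P g * (d * X g)) = d * (\<Sum>g\<in>A. P g * X g)"
      for A and P X :: "('a \<Rightarrow> 'a) \<Rightarrow> 'c" and d
      by (simp add: sum_distrib_left mult.left_commute)
    ultimately show ?thesis by (simp only:)
  qed
  finally show ?thesis .
qed

section \<open>Invariance of forest sums under relabelling\<close>

lemma forest_sum_cong:
  assumes "\<And>u v. u \<in> V - R \<Longrightarrow> v \<in> V \<Longrightarrow> w u v = w' u v"
  shows "forest_sum V R w = forest_sum V R w'"
  unfolding forest_sum_def
  by (intro sum.cong prod.cong refl assms) (auto intro: forests_in)

text \<open>Asking only for a left inverse \<open>\<tau>\<close> on \<open>V\<close> lets the lemma
  serve both directions of a bijection, with \<open>\<sigma>\<close> and \<open>\<tau>\<close>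
  exchanged.\<close>

lemma forests_transport:
  assumes f: "f \<in> forests V R" and R: "R \<subseteq> V"
    and \<sigma>: "\<sigma> ` V = V'" and \<tau>: "\<And>u. u \<in> V \<Longrightarrow> \<tau> (\<sigma> u) = u"
  shows "restrict (\<sigma> \<circ> f \<circ> \<tau>) (V' - \<sigma> ` R) \<in> forests V' (\<sigma> ` R)" (is "?g \<in> _")
proof -
  have inj: "u = u'" if "u \<in> V" "u' \<in> V" "\<sigma> u = \<sigma> u'" for u u'
    using that \<tau> by metis
  have g: "?g (\<sigma> u) = \<sigma> (f u)" if "u \<in> V - R" for u
  proof -
    have "\<sigma> u \<notin> \<sigma> ` R" using that inj R by blast
    then show ?thesis using that \<sigma> \<tau> by auto
  qed
  have "lands ?g (\<sigma> ` R) UNIV (\<sigma> a)" if "lands f R UNIV a" "a \<in> V" for a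
    using that
  proof (induction rule: lands.induct)
    case (stop a)
    then show ?case by (auto intro: lands.stop)
  next
    case (step a)
    have "lands ?g (\<sigma> ` R) UNIV (\<sigma> (f a))"
      using step.IH step.hyps step.prems forests_in[OF f, of a] by blast
    then have "lands ?g (\<sigma> ` R) UNIV (?g (\<sigma> a))"
      using g[of a] step by (simp only: Diff_iff simp_thms)
    moreover have "\<sigma> a \<notin> \<sigma> ` R" using step inj R by blast
    ultimately show ?case by (rule lands.step[rotated])
  qed
  then have "\<forall>b\<in>V'. lands ?g (\<sigma> ` R) UNIV b"
    using forests_lands[OF f] \<sigma> by auto
  moreover have "?g b \<in> V'" if "b \<in> V' - \<sigma> ` R" for b
  proof -
    obtain u where "b = \<sigma> u" "u \<in> V - R" using \<sigma> \<open>b \<in> V' - \<sigma> ` R\<close> by auto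
    then show ?thesis using g[of u] forests_in[OF f, of u] \<sigma> by auto
  qed
  then have "?g \<in> (V' - \<sigma> ` R) \<rightarrow>\<^sub>E V'" by (simp add: PiE_iff)
  ultimately show ?thesis by (simp add: forests_def)
qed

text \<open>It serves to identify a blow-up with singleton classes with its quotient, and to
  exchange twin roots.\<close>

lemma forest_sum_transport:
  assumes \<sigma>: "bij_betw \<sigma> V V'" and R: "R \<subseteq> V"
    and w: "\<And>u v. u \<in> V \<Longrightarrow> v \<in> V \<Longrightarrow> w' (\<sigma> u) (\<sigma> v) = w u v"
  shows "forest_sum V' (\<sigma> ` R) w' = forest_sum V R w"
proof -
  define \<tau> where "\<tau> = inv_into V \<sigma>"
  have im: "\<sigma> ` V = V'" and im': "\<tau> ` V' = V"
    using \<sigma> bij_betw_inv_into[OF \<sigma>] by (simp_all add: bij_betw_def \<tau>_def)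
  have \<tau>\<sigma>: "\<And>u. u \<in> V \<Longrightarrow> \<tau> (\<sigma> u) = u" and \<sigma>\<tau>: "\<And>u. u \<in> V' \<Longrightarrow> \<sigma> (\<tau> u) = u"
    using \<sigma> by (auto simp: \<tau>_def bij_betw_inv_into_left bij_betw_inv_into_right)
  have "\<tau> ` \<sigma> ` R = id ` R"
    unfolding image_image by (rule image_cong) (use R \<tau>\<sigma> in auto)
  then have R': "\<tau> ` \<sigma> ` R = R" by simp
  have RV: "\<sigma> ` R \<subseteq> V'" using R im by blast
  have \<sigma>R: "\<sigma> u \<in> \<sigma> ` R \<longleftrightarrow> u \<in> R" if "u \<in> V" for u
    using that R \<tau>\<sigma> by (metis image_iff subsetD)
  have pull_back: "restrict (\<tau> \<circ> g \<circ> \<sigma>) (V - R) \<in> forests V R" if "g \<in> forests V' (\<sigma> ` R)" for g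
    using forests_transport[OF that RV im' \<sigma>\<tau>] by (simp add: R')
  show ?thesis
    unfolding forest_sum_def
  proof (rule sum.reindex_bij_witness[where i = "\<lambda>f. restrict (\<sigma> \<circ> f \<circ> \<tau>) (V' - \<sigma> ` R)"
        and j = "\<lambda>g. restrict (\<tau> \<circ> g \<circ> \<sigma>) (V - R)"])
    fix g assume g: "g \<in> forests V' (\<sigma> ` R)"
    let ?f = "restrict (\<tau> \<circ> g \<circ> \<sigma>) (V - R)"
    have f: "?f (\<tau> b) = \<tau> (g b)" "\<sigma> (?f (\<tau> b)) = g b" if "b \<in> V' - \<sigma> ` R" for b
    proof -
      have "\<tau> b \<in> V" using that im' by blast
      moreover have "\<tau> b \<notin> R" using that \<sigma>\<tau>[of b] by (metis DiffD1 DiffD2 imageI)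
      ultimately show *: "?f (\<tau> b) = \<tau> (g b)" using that \<sigma>\<tau> by simp
      show "\<sigma> (?f (\<tau> b)) = g b" unfolding * using forests_in[OF g that] \<sigma>\<tau> by simp
    qed
    have ext: "g \<in> extensional (V' - \<sigma> ` R)" using g by (auto simp: forests_def PiE_def)
    show "restrict (\<sigma> \<circ> ?f \<circ> \<tau>) (V' - \<sigma> ` R) = g"
    proof
      fix b
      show "restrict (\<sigma> \<circ> ?f \<circ> \<tau>) (V' - \<sigma> ` R) b = g b"
        using f(2)[of b] ext by (cases "b \<in> V' - \<sigma> ` R") (auto simp: extensional_def)
    qed
    show "?f \<in> forests V R" by (rule pull_back[OF g])
    have bij: "bij_betw \<sigma> (V - R) (V' - \<sigma> ` R)"
      using inj_on_image_set_diff[of \<sigma> V V R] \<sigma> R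
      by (auto simp: bij_betw_def intro: inj_on_subset)
    have "(\<Prod>u\<in>V' - \<sigma> ` R. w' u (g u)) = (\<Prod>u\<in>V - R. w' (\<sigma> u) (g (\<sigma> u)))"
      by (rule prod.reindex_bij_betw[OF bij, symmetric])
    also have "\<dots> = (\<Prod>u\<in>V - R. w u (?f u))"
    proof (rule prod.cong[OF refl])
      fix u assume u: "u \<in> V - R"
      then have "g (\<sigma> u) \<in> V'" using forests_in[OF g, of "\<sigma> u"] bij by (auto simp: bij_betw_def)
      then have "\<tau> (g (\<sigma> u)) \<in> V" "\<sigma> (\<tau> (g (\<sigma> u))) = g (\<sigma> u)" using im' \<sigma>\<tau> by blast+
      then have "?f u \<in> V" "\<sigma> (?f u) = g (\<sigma> u)" using u by simp_all
      then show "w' (\<sigma> u) (g (\<sigma> u)) = w u (?f u)" using w[of u "?f u"] u by simp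
    qed
    finally show "(\<Prod>u\<in>V - R. w u (?f u)) = (\<Prod>u\<in>V' - \<sigma> ` R. w' u (g u))" ..
  next
    fix f assume f: "f \<in> forests V R"
    show "restrict (\<sigma> \<circ> f \<circ> \<tau>) (V' - \<sigma> ` R) \<in> forests V' (\<sigma> ` R)"
      by (rule forests_transport[OF f R im \<tau>\<sigma>])
    show "restrict (\<tau> \<circ> restrict (\<sigma> \<circ> f \<circ> \<tau>) (V' - \<sigma> ` R) \<circ> \<sigma>) (V - R) = f"
    proof
      fix u
      show "restrict (\<tau> \<circ> restrict (\<sigma> \<circ> f \<circ> \<tau>) (V' - \<sigma> ` R) \<circ> \<sigma>) (V - R) u = f u"
      proof (cases "u \<in> V - R")
        case True
        then have "\<sigma> u \<in> V' - \<sigma> ` R" using \<sigma>R im by blast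
        then show ?thesis using True \<tau>\<sigma>[of u] \<tau>\<sigma>[OF forests_in[OF f True]] by simp
      next
        case False
        then have "f u = undefined" using f by (auto simp: forests_def PiE_def extensional_def)
        then show ?thesis using False by (simp only: restrict_apply if_False)
      qed
    qed
  qed
qed

section \<open>Blow-ups\<close>

text \<open>The source enters only through its class, so members of a class are twins by
  construction.\<close>

definition blowup_weight ::
    "('v \<Rightarrow> 'i) \<Rightarrow> ('i \<Rightarrow> 'i \<Rightarrow> bool) \<Rightarrow> ('v \<Rightarrow> 'c) \<Rightarrow> 'v \<Rightarrow> 'v \<Rightarrow> 'c::comm_semiring_1" where
  "blowup_weight \<kappa> E c u v = (if E (\<kappa> u) (\<kappa> v) then c v else 0)"

text \<open>Merging within a class stays among blow-up weights, which lets the merging be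
  iterated.\<close>

lemma merge_blowup_weight:
  assumes "\<kappa> x = \<kappa> x'"
  shows "merge_weight x x' (blowup_weight \<kappa> E c) = blowup_weight \<kappa> E (c(x := c x + c x'))"
proof (intro ext)
  show "merge_weight x x' (blowup_weight \<kappa> E c) u v = blowup_weight \<kappa> E (c(x := c x + c x')) u v" for u v
    using assms by (cases "v = x") (simp_all add: merge_weight_def blowup_weight_def)
qed

text \<open>Row sums depend only on the class totals \<open>M\<close>, which merging preserves;
  hence every merge in a class yields the same factor.\<close>

lemma sum_blowup_weight:
  assumes "finite V" and M: "\<And>i. i \<in> \<kappa> ` V \<Longrightarrow> M i = (\<Sum>v | v \<in> V \<and> \<kappa> v = i. c v)"
  shows "(\<Sum>v\<in>V. blowup_weight \<kappa> E c x v) = (\<Sum>j | j \<in> \<kappa> ` V \<and> E (\<kappa> x) j. M j)"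
proof -
  have "(\<Sum>v\<in>V. blowup_weight \<kappa> E c x v) =
      (\<Sum>j\<in>\<kappa> ` V. \<Sum>v | v \<in> V \<and> \<kappa> v = j. blowup_weight \<kappa> E c x v)"
    by (rule sum.image_gen[OF assms(1)])
  also have "\<dots> = (\<Sum>j\<in>\<kappa> ` V. if E (\<kappa> x) j then M j else 0)"
    by (rule sum.cong) (auto simp: M blowup_weight_def)
  also have "\<dots> = (\<Sum>j | j \<in> \<kappa> ` V \<and> E (\<kappa> x) j. M j)"
    by (simp add: assms(1) sum.inter_filter)
  finally show ?thesis .
qed

text \<open>
  Summing over all roots in the class \<^term>\<open>k\<close> makes the merging step uniform: every root other
  than the twins \<^term>\<open>x\<close>, \<^term>\<open>x'\<close> contributes the same factor, and so do the two twin roots together.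
\<close>

lemma sum_forest_sum_merge:
  fixes c :: "'v \<Rightarrow> 'c::comm_semiring_1"
  assumes V: "finite V" "x \<in> V" "x' \<in> V" "x \<noteq> x'" and \<kappa>: "\<kappa> x = \<kappa> x'"
  shows "(\<Sum>u | u \<in> V \<and> \<kappa> u = k. forest_sum V {u} (blowup_weight \<kappa> E c)) =
    (\<Sum>v\<in>V. blowup_weight \<kappa> E c x v) *
    (\<Sum>u | u \<in> V - {x'} \<and> \<kappa> u = k.
      forest_sum (V - {x'}) {u} (blowup_weight \<kappa> E (c(x := c x + c x'))))"
proof -
  let ?w = "blowup_weight \<kappa> E c" and ?w' = "blowup_weight \<kappa> E (c(x := c x + c x'))"
  let ?d = "\<Sum>v\<in>V. ?w x v" and ?K = "{u. u \<in> V \<and> \<kappa> u = k}"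
  have twins: "?w x' v = ?w x v" for v by (simp add: blowup_weight_def \<kappa>)
  have other: "forest_sum V {u} ?w = ?d * forest_sum (V - {x'}) {u} ?w'"
    if "u \<in> V" "u \<noteq> x" "u \<noteq> x'" for u
    using forest_sum_merge_nonroots[of V x "{u}" x' ?w] V that twins
    by (simp add: merge_blowup_weight[of \<kappa> x x', OF \<kappa>])
  have roots: "forest_sum V {x} ?w + forest_sum V {x'} ?w = ?d * forest_sum (V - {x'}) {x} ?w'"
    using forest_sum_merge_roots[of V x x' ?w] V twins by (simp add: merge_blowup_weight[of \<kappa> x x', OF \<kappa>])
  show ?thesis
  proof (cases "\<kappa> x = k")
    case False
    then have K: "{u. u \<in> V - {x'} \<and> \<kappa> u = k} = ?K" using \<kappa> by auto
    show ?thesis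
      unfolding K sum_distrib_left
    proof (rule sum.cong[OF refl])
      fix u assume "u \<in> ?K"
      then show "forest_sum V {u} ?w = ?d * forest_sum (V - {x'}) {u} ?w'"
        using False \<kappa> by (intro other) auto
    qed
  next
    case True
    define L where "L = ?K - {x, x'}"
    have K: "?K = insert x (insert x' L)" and K': "{u. u \<in> V - {x'} \<and> \<kappa> u = k} = insert x L"
      using V \<kappa> True by (auto simp: L_def)
    have L: "finite L" "x \<notin> L" "x' \<notin> L" using V by (auto simp: L_def)
    have sum_L: "(\<Sum>u\<in>L. forest_sum V {u} ?w) = ?d * (\<Sum>u\<in>L. forest_sum (V - {x'}) {u} ?w')"
      unfolding sum_distrib_left
    proof (rule sum.cong[OF refl])
      fix u assume "u \<in> L"
      then show "forest_sum V {u} ?w = ?d * forest_sum (V - {x'}) {u} ?w'"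
        by (intro other) (auto simp: L_def)
    qed
    have "(\<Sum>u\<in>?K. forest_sum V {u} ?w) =
        forest_sum V {x} ?w + forest_sum V {x'} ?w + (\<Sum>u\<in>L. forest_sum V {u} ?w)"
      unfolding K using L V(4) by (simp add: add.assoc)
    also have "\<dots> = ?d * (\<Sum>u\<in>insert x L. forest_sum (V - {x'}) {u} ?w')"
      unfolding roots sum_L sum.insert[OF L(1,2)] distrib_left ..
    finally show ?thesis unfolding K' .
  qed
qed

text \<open>Induction on the number of vertices: a merge lowers one class size by one and yields one
  row sum, while \<open>M\<close> stays fixed and \<open>c\<close> varies. When all classes are
  singletons, \<open>\<kappa>\<close> is a weight-preserving bijection onto the quotient.\<close>

lemma sum_forest_sum_blowup:
  fixes c :: "'v \<Rightarrow> 'c::comm_semiring_1" and M :: "'i \<Rightarrow> 'c"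
  assumes "finite V" and "k \<in> \<kappa> ` V"
    and "\<And>i. i \<in> \<kappa> ` V \<Longrightarrow> M i = (\<Sum>v | v \<in> V \<and> \<kappa> v = i. c v)"
  shows "(\<Sum>u | u \<in> V \<and> \<kappa> u = k. forest_sum V {u} (blowup_weight \<kappa> E c)) =
    (\<Prod>i\<in>\<kappa> ` V. (\<Sum>j | j \<in> \<kappa> ` V \<and> E i j. M j) ^ (card {v. v \<in> V \<and> \<kappa> v = i} - 1)) *
    forest_sum (\<kappa> ` V) {k} (\<lambda>i j. if E i j then M j else 0)"
  using assms
proof (induction "card V" arbitrary: V c rule: less_induct)
  case less
  note V = less.prems(1) and k = less.prems(2) and M = less.prems(3)
  show ?case
  proof (cases "inj_on \<kappa> V")
    case True
    have cls: "{u. u \<in> V \<and> \<kappa> u = \<kappa> v} = {v}" if "v \<in> V" for v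
      using that True by (auto simp: inj_on_def)
    obtain r where r: "r \<in> V" "\<kappa> r = k" using k by auto
    have "forest_sum (\<kappa> ` V) (\<kappa> ` {r}) (\<lambda>i j. if E i j then M j else 0) =
        forest_sum V {r} (blowup_weight \<kappa> E c)"
      by (rule forest_sum_transport) (use True r M cls in \<open>auto simp: bij_betw_def blowup_weight_def\<close>)
    moreover have "(\<Prod>i\<in>\<kappa> ` V. (\<Sum>j | j \<in> \<kappa> ` V \<and> E i j. M j) ^
        (card {v. v \<in> V \<and> \<kappa> v = i} - 1)) = 1"
      by (rule prod.neutral) (auto simp: cls)
    ultimately show ?thesis using cls[OF r(1)] r(2) by simp
  next
    case False
    then obtain x x' where x: "x \<in> V" "x' \<in> V" "x \<noteq> x'" "\<kappa> x = \<kappa> x'" by (auto simp: inj_on_def)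
    let ?c = "c(x := c x + c x')" and ?U = "V - {x'}"
    let ?D = "\<lambda>i. \<Sum>j | j \<in> \<kappa> ` V \<and> E i j. M j"
    \<comment> \<open>The class of \<open>x'\<close> still contains \<open>x\<close>, so no class
      disappears.\<close>
    have "V = insert x' ?U" "\<kappa> x' \<in> \<kappa> ` ?U" using x by (auto intro: rev_image_eqI[of x])
    then have im: "\<kappa> ` ?U = \<kappa> ` V" by (metis image_insert insert_absorb)
    have M': "M i = (\<Sum>v | v \<in> ?U \<and> \<kappa> v = i. ?c v)" if "i \<in> \<kappa> ` ?U" for i
    proof (cases "i = \<kappa> x")
      case True
      let ?L = "{v. v \<in> V \<and> \<kappa> v = i} - {x, x'}"
      have V_i: "{v. v \<in> V \<and> \<kappa> v = i} = insert x (insert x' ?L)"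
        and U_i: "{v. v \<in> ?U \<and> \<kappa> v = i} = insert x ?L"
        using x True by auto
      have fin: "finite ?L" using V by simp
      have "(\<Sum>v\<in>?L. ?c v) = (\<Sum>v\<in>?L. c v)" by (rule sum.cong) auto
      then have "(\<Sum>v\<in>insert x ?L. ?c v) = c x + c x' + (\<Sum>v\<in>?L. c v)"
        using fin by (subst sum.insert) simp_all
      also have "\<dots> = (\<Sum>v\<in>insert x (insert x' ?L). c v)"
        using fin x(3) by (subst sum.insert, simp, simp)+ (simp add: add.assoc)
      also have "\<dots> = M i"
        using M[of i] that unfolding im V_i[symmetric] by simp
      finally show ?thesis unfolding U_i ..
    next
      case False
      then have "{v. v \<in> ?U \<and> \<kappa> v = i} = {v. v \<in> V \<and> \<kappa> v = i}" using x by auto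
      moreover have "(\<Sum>v | v \<in> V \<and> \<kappa> v = i. ?c v) = (\<Sum>v | v \<in> V \<and> \<kappa> v = i. c v)"
        using False by (intro sum.cong) auto
      ultimately show ?thesis using M[of i] that unfolding im by simp
    qed
    have step: "?D i ^ (card {v. v \<in> V \<and> \<kappa> v = i} - 1) =
        (if i = \<kappa> x then ?D i else 1) * ?D i ^ (card {v. v \<in> ?U \<and> \<kappa> v = i} - 1)" for i
    proof (cases "i = \<kappa> x")
      case True
      let ?A = "{v. v \<in> ?U \<and> \<kappa> v = i}"
      have "{v. v \<in> V \<and> \<kappa> v = i} = insert x' ?A" using x True by auto
      then have "card {v. v \<in> V \<and> \<kappa> v = i} = Suc (card ?A)" using V by simp
      \<comment> \<open>Positivity keeps the truncated subtraction in the exponent honest.\<close>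
      moreover have "card ?A > 0" using V x True by (auto simp: card_gt_0_iff)
      ultimately show ?thesis using True by (cases "card ?A") simp_all
    next
      case False
      then have "{v. v \<in> ?U \<and> \<kappa> v = i} = {v. v \<in> V \<and> \<kappa> v = i}" using x by auto
      then show ?thesis using False by simp
    qed
    have "card ?U < card V" using V x by (metis card_Diff1_less)
    then have "(\<Sum>u | u \<in> ?U \<and> \<kappa> u = k. forest_sum ?U {u} (blowup_weight \<kappa> E ?c)) =
        (\<Prod>i\<in>\<kappa> ` V. ?D i ^ (card {v. v \<in> ?U \<and> \<kappa> v = i} - 1)) *
        forest_sum (\<kappa> ` V) {k} (\<lambda>i j. if E i j then M j else 0)"
      using less.hyps[of ?U ?c] M' k V unfolding im by simp
    moreover have "(\<Prod>i\<in>\<kappa> ` V. ?D i ^ (card {v. v \<in> V \<and> \<kappa> v = i} - 1)) =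
        ?D (\<kappa> x) * (\<Prod>i\<in>\<kappa> ` V. ?D i ^ (card {v. v \<in> ?U \<and> \<kappa> v = i} - 1))"
      unfolding step prod.distrib using V x(1) by (simp add: prod.delta)
    moreover have "(\<Sum>v\<in>V. blowup_weight \<kappa> E c x v) = ?D (\<kappa> x)"
      by (rule sum_blowup_weight) (use V M in auto)
    ultimately show ?thesis
      unfolding sum_forest_sum_merge[OF V x]
      by (simp only: mult.assoc)
  qed
qed

text \<open>With constant vertex weights, exchanging two members of a class is an
  automorphism.\<close>

lemma forest_sum_twin_root:
  assumes "x \<in> V" "y \<in> V" "\<kappa> x = \<kappa> y"
  shows "forest_sum V {x} (blowup_weight \<kappa> E (\<lambda>_. 1)) = forest_sum V {y} (blowup_weight \<kappa> E (\<lambda>_. 1))"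
proof -
  have \<kappa>: "\<kappa> (transpose x y u) = \<kappa> u" for u using assms by (auto simp: transpose_def)
  have "bij_betw (transpose x y) V V"
    using assms by (simp add: bij_betw_def inj_on_subset[OF inj_transpose])
  from forest_sum_transport[OF this, of "{x}" "blowup_weight \<kappa> E (\<lambda>_. 1)" "blowup_weight \<kappa> E (\<lambda>_. 1)"]
  show ?thesis using assms by (simp add: blowup_weight_def \<kappa> eq_commute)
qed

section \<open>Oriented spanning trees as parent functions\<close>

text \<open>Every nonempty closed walk contains a cycle, so the walk-based notion agrees with
  acyclicity of the arc relation.\<close>

lemma forest_iff_acyclic:
  assumes "pair_wf_digraph T"
  shows "forest (with_proj T) \<longleftrightarrow> acyclic (parcs T)"
proof -
  interpret pair_wf_digraph T by (rule assms)
  have "(\<exists>p. cycle p) \<longleftrightarrow> (\<exists>u. (u, u) \<in> (parcs T)\<^sup>+)"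
  proof
    assume "\<exists>p. cycle p"
    then show "\<exists>u. (u, u) \<in> (parcs T)\<^sup>+"
      by (auto simp: cycle_def dest: reachable1_awalkI)
  next
    assume "\<exists>u. (u, u) \<in> (parcs T)\<^sup>+"
    then obtain u p where "awalk u p u" "p \<noteq> []" by (auto simp: reachable1_awalk)
    then have "closed_w p" by (auto simp: closed_w_def)
    then show "\<exists>p. cycle p" by (rule closed_w_imp_cycle)
  qed
  then show ?thesis by (auto simp: forest_def acyclic_def)
qed

definition functional_tree :: "'a set \<Rightarrow> 'a \<Rightarrow> ('a \<Rightarrow> 'a) \<Rightarrow> 'a pair_pre_digraph" where
  "functional_tree V v f = \<lparr>pverts = V, parcs = (\<lambda>u. (u, f u)) ` (V - {v})\<rparr>"

lemma functional_tree_simps [simp]: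
  "pverts (functional_tree V v f) = V"
  "parcs (functional_tree V v f) = (\<lambda>u. (u, f u)) ` (V - {v})"
  by (simp_all add: functional_tree_def)

text \<open>That all orbits reach \<open>v\<close> gives both tree properties: a cycle could be
  pushed along its orbit to \<open>v\<close>, which has no outgoing arc, and any two vertices are
  joined through \<open>v\<close>.\<close>

lemma functional_tree_in_oriented_spanning_trees:
  assumes G: "pair_fin_digraph G" and v: "v \<in> pverts G"
    and f: "f \<in> forests (pverts G) {v}" and arcs: "\<And>u. u \<in> pverts G - {v} \<Longrightarrow> (u, f u) \<in> parcs G"
  shows "functional_tree (pverts G) v f \<in> oriented_spanning_trees G v"
proof -
  interpret G: pair_fin_digraph G by (rule G)
  let ?V = "pverts G"
  define T where "T = functional_tree ?V v f"
  have pv: "pverts T = ?V" and pa: "parcs T = (\<lambda>u. (u, f u)) ` (?V - {v})" by (simp_all add: T_def)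
  interpret T: pair_wf_digraph T
    by unfold_locales (auto simp: pv pa intro!: forests_in[OF f])
  interpret S: pair_wf_digraph "mk_symmetric (with_proj T)" ..
  have sub: "parcs T \<subseteq> parcs G" using arcs by (auto simp: pa)
  have acyc: "(a, a) \<notin> (parcs T)\<^sup>+" if "lands f {v} UNIV a" for a
    using that
  proof (induction rule: lands.induct)
    case (stop a)
    then show ?case by (auto simp: pa dest: tranclD)
  next
    case (step a)
    show ?case
    proof
      assume "(a, a) \<in> (parcs T)\<^sup>+"
      then obtain b where b: "(a, b) \<in> parcs T" "(b, a) \<in> (parcs T)\<^sup>*" by (auto dest: tranclD)
      then have "b = f a" by (auto simp: pa)
      then have "(f a, f a) \<in> (parcs T)\<^sup>+" using b by auto
      then show False using step by simp
    qed
  qed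
  have "acyclic (parcs T)"
    unfolding acyclic_def
  proof (intro allI notI)
    fix a assume a: "(a, a) \<in> (parcs T)\<^sup>+"
    then have "a \<in> ?V" by (auto simp: pa dest: tranclD)
    then show False using acyc[OF forests_lands[OF f]] a by blast
  qed
  then have "forest (with_proj T)" by (simp add: forest_iff_acyclic[OF T.pair_wf_digraph_axioms])
  moreover have "connected (with_proj T)"
  proof -
    have to_v: "a \<rightarrow>\<^sup>*\<^bsub>with_proj T\<^esub> v" if "lands f {v} UNIV a" "a \<in> ?V" for a
      using that
    proof (induction rule: lands.induct)
      case (stop a)
      then show ?case using T.reachable_refl[of v] by (simp add: pv)
    next
      case (step a)
      then have "f a \<rightarrow>\<^sup>*\<^bsub>with_proj T\<^esub> v" using forests_in[OF f, of a] by simp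
      moreover have "(a, f a) \<in> parcs T" using step by (simp add: pa)
      ultimately show ?case by (rule T.adj_reachable_trans[rotated])
    qed
    have sym_v: "a \<rightarrow>\<^sup>*\<^bsub>mk_symmetric (with_proj T)\<^esub> v" "v \<rightarrow>\<^sup>*\<^bsub>mk_symmetric (with_proj T)\<^esub> a"
      if "a \<in> ?V" for a
    proof -
      show *: "a \<rightarrow>\<^sup>*\<^bsub>mk_symmetric (with_proj T)\<^esub> v"
        by (rule T.reachable_mk_symmetricI[OF to_v[OF forests_lands[OF f that] that]])
      show "v \<rightarrow>\<^sup>*\<^bsub>mk_symmetric (with_proj T)\<^esub> a"
        by (rule symmetric_reachable[OF symmetric_mk_symmetric *])
    qed
    show ?thesis
      unfolding connected_def strongly_connected_def
    proof (intro conjI ballI)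
      show "verts (with_proj (mk_symmetric (with_proj T))) \<noteq> {}" using v by (auto simp: pv)
      fix a b
      assume "a \<in> verts (with_proj (mk_symmetric (with_proj T)))"
        "b \<in> verts (with_proj (mk_symmetric (with_proj T)))"
      then show "a \<rightarrow>\<^sup>*\<^bsub>mk_symmetric (with_proj T)\<^esub> b"
        using S.reachable_trans[OF sym_v(1) sym_v(2)] by (simp add: pv)
    qed
  qed
  moreover have "spanning (with_proj T) (with_proj G)"
    using sub G.wf_digraph T.wf_digraph
    by (auto simp: spanning_def subgraph_def pv compatible_def)
  moreover have "out_arcs (with_proj T) u = (if u = v then {} else {(u, f u)})" if "u \<in> ?V" for u
    using that by (auto simp: out_arcs_def pa)
  ultimately show ?thesis
    using v unfolding T_def[symmetric] oriented_spanning_trees_def spanning_tree_def tree_def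
    by (simp add: pv out_degree_def)
qed

text \<open>Outdegree 1 defines the parent function. As the arc relation is finite and acyclic, its
  converse is well-founded, so following parents must end at \<open>v\<close>.\<close>

lemma oriented_spanning_tree_functional:
  assumes G: "pair_fin_digraph G" and T: "T \<in> oriented_spanning_trees G v"
  obtains f where "f \<in> forests (pverts G) {v}" "T = functional_tree (pverts G) v f"
    "\<And>u. u \<in> pverts G - {v} \<Longrightarrow> (u, f u) \<in> parcs G"
proof -
  let ?V = "pverts G"
  have sub: "pverts T = ?V" "parcs T \<subseteq> parcs G" "wf_digraph (with_proj T)" "forest (with_proj T)"
    and root: "out_degree (with_proj T) v = 0"
    and outdeg: "\<And>u. u \<in> ?V - {v} \<Longrightarrow> out_degree (with_proj T) u = 1"
    using T by (auto simp: oriented_spanning_trees_def spanning_tree_def tree_def spanning_def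
        subgraph_def)
  interpret T: pair_wf_digraph T using sub(3) by (simp add: wf_digraph_wp_iff)
  \<comment> \<open>\<open>out_degree\<close> is a cardinality, and infinite sets also have
    \<open>card\<close> 0; only finiteness turns outdegree 0 of the root into absence of
    arcs.\<close>
  have fin: "finite (parcs T)" using sub(2) G pair_fin_digraph.pair_finite_arcs finite_subset by blast
  have out: "out_arcs (with_proj T) u = {e \<in> parcs T. fst e = u}" for u by (auto simp: out_arcs_def)
  have no_out: "(v, b) \<notin> parcs T" for b
    using root fin by (auto simp: out_degree_def out)
  have "\<exists>b. {e \<in> parcs T. fst e = u} = {(u, b)}" if u: "u \<in> ?V - {v}" for u
  proof -
    obtain e where e: "{e \<in> parcs T. fst e = u} = {e}"
      using outdeg[OF u] by (auto simp: out_degree_def out card_1_singleton_iff)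
    then have "fst e = u" by blast
    then have "e = (u, snd e)" by (cases e) simp
    with e have "{e \<in> parcs T. fst e = u} = {(u, snd e)}" by (simp only:)
    then show ?thesis ..
  qed
  then have "\<forall>u\<in>?V - {v}. \<exists>b. {e \<in> parcs T. fst e = u} = {(u, b)}" ..
  from bchoice[OF this] obtain h
    where "\<forall>u\<in>?V - {v}. {e \<in> parcs T. fst e = u} = {(u, h u)}" ..
  then have h: "{e \<in> parcs T. fst e = u} = {(u, h u)}" if "u \<in> ?V - {v}" for u using that ..
  define f where "f = restrict h (?V - {v})"
  have arc: "(u, b) \<in> parcs T \<longleftrightarrow> u \<in> ?V - {v} \<and> b = f u" for u b
  proof (cases "u \<in> ?V - {v}")
    case True
    have "(u, b) \<in> parcs T \<longleftrightarrow> (u, b) \<in> {e \<in> parcs T. fst e = u}" by simp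
    also have "\<dots> \<longleftrightarrow> b = h u" unfolding h[OF True] by simp
    finally show ?thesis using True by (simp add: f_def)
  next
    case False
    then show ?thesis using no_out T.in_arcsD1[of u b, unfolded sub(1)] by blast
  qed
  have fV: "f u \<in> ?V" if "u \<in> ?V - {v}" for u
    using arc[of u "f u"] that T.in_arcsD2[of u "f u", unfolded sub(1)] by blast
  have "acyclic (parcs T)" using sub(4) by (simp add: forest_iff_acyclic[OF T.pair_wf_digraph_axioms])
  then have wf: "wf ((parcs T)\<inverse>)" using fin by (simp add: finite_acyclic_wf_converse)
  have "lands f {v} UNIV a" if "a \<in> ?V" for a
    using wf that
  proof (induction a rule: wf_induct_rule)
    case (less a)
    show ?case
    proof (cases "a = v")
      case False
      then have "(a, f a) \<in> parcs T" using less arc by simp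
      then have "lands f {v} UNIV (f a)" using less.IH[of "f a"] fV[of a] False less.prems by simp
      then show ?thesis using False by (auto intro: lands.step)
    qed (auto intro: lands.stop)
  qed
  then have "f \<in> forests ?V {v}" using fV by (auto simp: forests_def f_def)
  moreover have "T = functional_tree ?V v f"
    using sub(1) arc by (auto intro!: pair_pre_digraph.equality simp: image_iff)
  moreover have "(u, f u) \<in> parcs G" if "u \<in> ?V - {v}" for u
    using arc[of u "f u"] that sub(2) by auto
  ultimately show ?thesis by (rule that)
qed

text \<open>Trees correspond to the parent functions that use only arcs of \<open>G\<close>; all
  other forests contain a factor 0.\<close>

lemma sum_oriented_spanning_trees:
  fixes w :: "'a \<Rightarrow> 'a \<Rightarrow> 'c::comm_semiring_1"
  assumes G: "pair_fin_digraph G" and v: "v \<in> pverts G"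
  shows "(\<Sum>T\<in>oriented_spanning_trees G v. \<Prod>(i, j)\<in>parcs T. w i j) =
    forest_sum (pverts G) {v} (\<lambda>i j. if (i, j) \<in> parcs G then w i j else 0)"
proof -
  let ?V = "pverts G"
  let ?F = "{f \<in> forests ?V {v}. \<forall>u\<in>?V - {v}. (u, f u) \<in> parcs G}"
  have fin: "finite ?V" using G by (rule pair_fin_digraph.pair_finite_verts)
  have "inj_on (functional_tree ?V v) ?F"
  proof (rule inj_onI)
    fix f g assume f: "f \<in> ?F" and g: "g \<in> ?F" and "functional_tree ?V v f = functional_tree ?V v g"
    then have "(\<lambda>u. (u, f u)) ` (?V - {v}) = (\<lambda>u. (u, g u)) ` (?V - {v})"
      by (metis functional_tree_simps(2))
    then have "f u = g u" if "u \<in> ?V - {v}" for u using that by blast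
    then show "f = g" using f g by (auto simp: forests_def intro: PiE_ext)
  qed
  moreover have "functional_tree ?V v ` ?F = oriented_spanning_trees G v"
    using functional_tree_in_oriented_spanning_trees[OF G v]
    by (auto elim!: oriented_spanning_tree_functional[OF G])
  ultimately have "(\<Sum>T\<in>oriented_spanning_trees G v. \<Prod>(i, j)\<in>parcs T. w i j) =
      (\<Sum>f\<in>?F. \<Prod>(i, j)\<in>parcs (functional_tree ?V v f). w i j)"
    by (metis (no_types, lifting) sum.reindex_cong)
  also have "\<dots> = (\<Sum>f\<in>?F. \<Prod>u\<in>?V - {v}. w u (f u))"
    by (simp add: prod.reindex inj_on_def)
  also have "\<dots> = forest_sum ?V {v} (\<lambda>i j. if (i, j) \<in> parcs G then w i j else 0)"
    unfolding forest_sum_def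
  proof (rule sum.mono_neutral_cong_left)
    show "\<forall>f\<in>forests ?V {v} - ?F. (\<Prod>u\<in>?V - {v}. if (u, f u) \<in> parcs G then w u (f u) else 0) = 0"
      using fin by (auto intro!: prod_zero)
  qed (auto simp: finite_forests fin intro!: prod.cong)
  finally show ?thesis .
qed

section \<open>Counting the oriented spanning trees of the join\<close>

theorem theorem4p4:
  fixes n :: nat and G :: "nat pair_pre_digraph"
    and H :: "nat \<Rightarrow> 'b pair_pre_digraph" and m :: "nat \<Rightarrow> nat"
  assumes "pair_digraph G" and "pverts G = {1..n}"
    and "\<And>i. i \<in> pverts G \<Longrightarrow> pair_digraph (H i)"
    and "\<And>i. i \<in> pverts G \<Longrightarrow> pverts (H i) \<noteq> {}"
    and "\<And>i. i \<in> pverts G \<Longrightarrow> parcs (H i) = {}"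
    and "\<And>i. i \<in> pverts G \<Longrightarrow> card (pverts (H i)) = m i"
    and "istar \<in> pverts G" and "ustar \<in> pverts (H istar)"
  shows "real (num_oriented_spanning_trees (generalized_join G H) (istar, ustar)) =
    1 / real (m istar) *
    (\<Prod>i \<in> pverts G. \<Prod>k = 1..m i - 1. \<Sum>j | (i, j) \<in> parcs G. real (m j)) *
    (\<Sum>T \<in> oriented_spanning_trees G istar. \<Prod>(i, j) \<in> parcs T. real (m j))"
proof -
  interpret G: pair_digraph G by (rule assms(1))
  let ?J = "generalized_join G H" and ?E = "\<lambda>i j. (i, j) \<in> parcs G"
  let ?V = "SIGMA i:pverts G. pverts (H i)"
  let ?w = "blowup_weight fst ?E (\<lambda>_::nat \<times> 'b. 1::real)"
  have finH: "finite (pverts (H i))" if "i \<in> pverts G" for i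
    using assms(3)[OF that] by (simp add: pair_digraph_def pair_fin_digraph.pair_finite_verts)
  have V: "pverts ?J = ?V" by (simp add: generalized_join_def)
  have finV: "finite ?V" using G.pair_finite_verts finH by auto
  \<comment> \<open>Within a class there are no arcs, as each \<open>H i\<close> is independent;
    since \<open>G\<close> has no loops, adjacency of the classes expresses this case too.\<close>
  have J: "(p, q) \<in> parcs ?J \<longleftrightarrow> (fst p, fst q) \<in> parcs G" if "p \<in> ?V" "q \<in> ?V" for p q
    using that assms(5) G.pair_no_loops[of "(fst p, fst q)"]
    by (cases p; cases q) (auto simp: generalized_join_def)
  have J_sub: "parcs ?J \<subseteq> ?V \<times> ?V" by (auto simp: generalized_join_def)
  have finJ: "pair_fin_digraph ?J"
    by unfold_locales (use J_sub finV in \<open>auto simp: V intro: finite_subset\<close>)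
  have im: "fst ` ?V = pverts G" using assms(4) by (force simp: image_iff)
  have cls: "{p. p \<in> ?V \<and> fst p = i} = Pair i ` pverts (H i)" if "i \<in> pverts G" for i
    using that by auto
  have card_cls: "card {p. p \<in> ?V \<and> fst p = i} = m i" if "i \<in> pverts G" for i
    using assms(6)[OF that] by (simp add: cls[OF that] card_image inj_on_def)
  have nbrs: "{j. j \<in> pverts G \<and> (i, j) \<in> parcs G} = {j. (i, j) \<in> parcs G}" for i
    using G.in_arcsD2 by auto
  have root: "(istar, ustar) \<in> ?V" using assms(7,8) by auto
  have "real (num_oriented_spanning_trees ?J (istar, ustar)) =
      (\<Sum>T\<in>oriented_spanning_trees ?J (istar, ustar). \<Prod>(p, q)\<in>parcs T. 1)"
    by (simp add: num_oriented_spanning_trees_def case_prod_unfold)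
  also have "\<dots> = forest_sum ?V {(istar, ustar)} (\<lambda>p q. if (p, q) \<in> parcs ?J then 1 else 0)"
    using sum_oriented_spanning_trees[OF finJ, of "(istar, ustar)"] root unfolding V by blast
  also have "\<dots> = forest_sum ?V {(istar, ustar)} ?w"
    by (rule forest_sum_cong) (auto simp: J blowup_weight_def)
  finally have count: "real (num_oriented_spanning_trees ?J (istar, ustar)) =
      forest_sum ?V {(istar, ustar)} ?w" .
  \<comment> \<open>The blow-up formula sums over all roots in the class of \<open>istar\<close>;
    these contribute equally, which is the source of the factor
    \<open>1 / real (m istar)\<close>.\<close>
  have "(\<Sum>p | p \<in> ?V \<and> fst p = istar. forest_sum ?V {p} ?w) =
      (\<Sum>p | p \<in> ?V \<and> fst p = istar. forest_sum ?V {(istar, ustar)} ?w)"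
    by (rule sum.cong[OF refl], rule forest_sum_twin_root) (use root in auto)
  also have "\<dots> = real (m istar) * forest_sum ?V {(istar, ustar)} ?w"
    using card_cls[OF assms(7)] by simp
  finally have "real (m istar) * forest_sum ?V {(istar, ustar)} ?w =
      (\<Prod>i\<in>pverts G. (\<Sum>j | (i, j) \<in> parcs G. real (m j)) ^ (m i - 1)) *
      forest_sum (pverts G) {istar} (\<lambda>i j. if (i, j) \<in> parcs G then real (m j) else 0)"
    \<comment> \<open>With unit vertex weights the class totals are the class sizes
      \<open>m i\<close>.\<close>
    using sum_forest_sum_blowup[of ?V istar fst "\<lambda>i. real (m i)" "\<lambda>_. 1" ?E] finV assms(7)
    by (simp add: im card_cls nbrs cong: prod.cong)
  moreover have "m istar > 0"
    using assms(4,6)[OF assms(7)] finH[OF assms(7)] by (simp add: card_gt_0_iff flip: assms(6)[OF assms(7)])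
  ultimately show ?thesis
    using sum_oriented_spanning_trees[OF G.pair_fin_digraph_axioms assms(7), of "\<lambda>_ j. real (m j)"]
    by (simp add: count field_simps)
qed

end
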